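(* Let $\theta\in\mathbb{R}$ be such that $\hbar=\tan\theta$ is defined and nonzero, and let $\mathcal{A}_\theta$ be the noncommutative torus with the elements $X^1,\dots,X^4$, the projectors $\Pi$, $\mathcal{D}=\mathbb{1}-\Pi$ and the curvature components $\tilde{R}^{ijkl}$ as defined in the context. Then the curvature of $\mathcal{A}_\theta$ vanishes, i.e. $$\tilde{R}^{ijkl}=0\qquad\text{for all } i,j,k,l\in\{1,2,3,4\}.$$
   Context: Repeated indices are summed over $\{1,2,3,4\}$; there is no difference between upper and lower indices. The noncommutative torus $\mathcal{A}_\theta$ is the unital associative $*$-algebra over $\mathbb{C}$ on two unitary generators $U,V$ with the relation $VU=qUV$, $q=e^{2i\theta}$. Define the hermitian elements $$X^1=\tfrac{1}{2\sqrt2}(U^*+U),\quad X^2=\tfrac{i}{2\sqrt2}(U^*-U),\quad X^3=\tfrac{1}{2\sqrt2}(V^*+V),\quad X^4=\tfrac{i}{2\sqrt2}(V^*-V),$$ and set $\hbar=\tan\theta$. The matrix $\Pi=(\Pi^{ij})_{i,j=1}^4$ over $\mathcal{A}_\theta$ is defined by $\Pi^{ij}=2X^iX^j$ if $i,j\in\{1,2\}$ or $i,j\in\{3,4\}$, and $\Pi^{ij}=0$ otherwise; it is a projection acting on the free right module $\mathcal{A}_\theta^4$, and $\mathcal{D}=\mathbb{1}-\Pi$. The inner derivations are $\partial^i(a)=\frac{1}{i\hbar}[X^i,a]$. On $T\mathcal{A}_\theta=\mathcal{D}(\mathcal{A}_\theta^4)$ one has the connection $\nabla^iW=\nabla_{\partial^i}W=e_k\mathcal{D}^{kl}\partial^i(W^l)$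 for $W=e_kW^k$, where $\{e_k\}$ is the canonical basis of $\mathcal{A}_\theta^4$. Its curvature $\nabla^i\nabla^jW-\nabla^j\nabla^iW-\nabla_{[\partial^i,\partial^j]}W$ equals $e_k\tilde{R}^{ijkl}W^l$ with components defined by $$\tilde{R}^{ijkl}=\partial^i(\mathcal{D}^{km})\,\partial^j(\mathcal{D}^{ml})-\partial^j(\mathcal{D}^{km})\,\partial^i(\mathcal{D}^{ml}).$$ *)

theory Defs
  imports
    Complex_Main
    "HOL-Library.Poly_Mapping"
    "HOL-Algebra.QuotRing"
    "HOL-Algebra.Module"
    "HOL-Algebra.Algebraic_Closure_Type"
begin

section \<open>The free unital complex *-algebra on two generators\<close>

datatype letter = LU | LUadj | LV | LVadj

text \<open>Words form the free monoid on the letters. It is written additively because the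
  convolution product on \<^typ>\<open>'a \<Rightarrow>\<^sub>0 'b\<close> expects an additive index monoid.\<close>

datatype word = Word (letters: "letter list")

instantiation word :: monoid_add
begin

definition zero_word :: word where "0 = Word []"

definition plus_word :: "word \<Rightarrow> word \<Rightarrow> word" where
  "v + w = Word (letters v @ letters w)"

instance
  by standard (simp_all add: zero_word_def plus_word_def)

end

type_synonym free_alg = "word \<Rightarrow>\<^sub>0 complex"

definition gen :: "letter \<Rightarrow> free_alg" where
  "gen x = Poly_Mapping.single (Word [x]) 1"

definition scalar :: "complex \<Rightarrow> free_alg" where
  "scalar c = Poly_Mapping.single 0 c"

fun letter_adj :: "letter \<Rightarrow> letter" where
  "letter_adj LU = LUadj"
| "letter_adj LUadj = LU"
| "letter_adj LV = LVadj"
| "letter_adj LVadj = LV"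

definition word_adj :: "word \<Rightarrow> word" where
  "word_adj w = Word (rev (map letter_adj (letters w)))"

text \<open>The conjugate-linear, product-reversing involution.\<close>

definition free_adj :: "free_alg \<Rightarrow> free_alg" where
  "free_adj p =
     (\<Sum>w\<in>Poly_Mapping.keys p. Poly_Mapping.single (word_adj w) (cnj (Poly_Mapping.lookup p w)))"

abbreviation free_ring :: "free_alg ring" where
  "free_ring \<equiv> ring_of_type_algebra"


section \<open>The noncommutative torus\<close>

definition torus_q :: "real \<Rightarrow> complex" where
  "torus_q \<theta> = exp (2 * \<i> * complex_of_real \<theta>)"

definition torus_relators :: "real \<Rightarrow> free_alg set" where
  "torus_relators \<theta> =
     {gen LU * gen LUadj - 1, gen LUadj * gen LU - 1,
      gen LV * gen LVadj - 1, gen LVadj * gen LV - 1,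
      gen LV * gen LU - scalar (torus_q \<theta>) * gen LU * gen LV}"

text \<open>Adding the adjoints of the relators makes the generated two-sided ideal closed under the
  involution, so that the quotient is a *-algebra. The ideal is a complex subspace because
  the scalars lie in the free algebra.\<close>

definition torus_ideal :: "real \<Rightarrow> free_alg set" where
  "torus_ideal \<theta> = Idl\<^bsub>free_ring\<^esub> (torus_relators \<theta> \<union> free_adj ` torus_relators \<theta>)"

record ('a, 'b) star_algebra = "('a, 'b) module" +
  adj :: "'b \<Rightarrow> 'b"

text \<open>Elements of the quotient are cosets. In \<open>smult\<close> the union, and not merely the
  image, is needed: for \<open>c = 0\<close> the image of a coset is only a singleton.\<close>

definition nc_torus :: "real \<Rightarrow> (complex, free_alg set) star_algebra" where
  "nc_torus \<theta> = (let I = torus_ideal \<theta>; Q = free_ring Quot I in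
     \<lparr> carrier = carrier Q, monoid.mult = monoid.mult Q, one = one Q, zero = zero Q, add = add Q,
       module.smult = (\<lambda>c A. \<Union>a\<in>A. I +>\<^bsub>free_ring\<^esub> (scalar c * a)),
       adj = (\<lambda>A. free_adj ` A) \<rparr>)"

definition torus_U :: "real \<Rightarrow> free_alg set" where
  "torus_U \<theta> = torus_ideal \<theta> +>\<^bsub>free_ring\<^esub> gen LU"

definition torus_V :: "real \<Rightarrow> free_alg set" where
  "torus_V \<theta> = torus_ideal \<theta> +>\<^bsub>free_ring\<^esub> gen LV"


section \<open>Embedding coordinates, projectors and curvature\<close>

text \<open>Indices range over \<open>{1..4}\<close>; the values at other indices are irrelevant.\<close>

definition torus_X :: "real \<Rightarrow> nat \<Rightarrow> free_alg set" where
  "torus_X \<theta> i =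
    (let A = nc_torus \<theta>; U = torus_U \<theta>; V = torus_V \<theta>;
         r = complex_of_real (1 / (2 * sqrt 2)) in
     if i = 1 then r \<odot>\<^bsub>A\<^esub> (adj A U \<oplus>\<^bsub>A\<^esub> U)
     else if i = 2 then (\<i> * r) \<odot>\<^bsub>A\<^esub> (adj A U \<ominus>\<^bsub>A\<^esub> U)
     else if i = 3 then r \<odot>\<^bsub>A\<^esub> (adj A V \<oplus>\<^bsub>A\<^esub> V)
     else (\<i> * r) \<odot>\<^bsub>A\<^esub> (adj A V \<ominus>\<^bsub>A\<^esub> V))"

definition torus_hbar :: "real \<Rightarrow> real" where
  "torus_hbar \<theta> = tan \<theta>"

definition torus_Pi :: "real \<Rightarrow> nat \<Rightarrow> nat \<Rightarrow> free_alg set" where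
  "torus_Pi \<theta> i j =
    (let A = nc_torus \<theta> in
     if (i \<in> {1, 2} \<and> j \<in> {1, 2}) \<or> (i \<in> {3, 4} \<and> j \<in> {3, 4})
     then 2 \<odot>\<^bsub>A\<^esub> (torus_X \<theta> i \<otimes>\<^bsub>A\<^esub> torus_X \<theta> j)
     else \<zero>\<^bsub>A\<^esub>)"

definition torus_D :: "real \<Rightarrow> nat \<Rightarrow> nat \<Rightarrow> free_alg set" where
  "torus_D \<theta> i j =
    (let A = nc_torus \<theta> in (if i = j then \<one>\<^bsub>A\<^esub> else \<zero>\<^bsub>A\<^esub>) \<ominus>\<^bsub>A\<^esub> torus_Pi \<theta> i j)"

definition torus_deriv :: "real \<Rightarrow> nat \<Rightarrow> free_alg set \<Rightarrow> free_alg set" where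
  "torus_deriv \<theta> i a =
    (let A = nc_torus \<theta>; x = torus_X \<theta> i in
     (1 / (\<i> * complex_of_real (torus_hbar \<theta>))) \<odot>\<^bsub>A\<^esub> (x \<otimes>\<^bsub>A\<^esub> a \<ominus>\<^bsub>A\<^esub> a \<otimes>\<^bsub>A\<^esub> x))"

text \<open>Components of the curvature of the connection
  \<open>\<nabla>\<^sup>i W = e\<^sub>k D\<^sup>k\<^sup>l \<partial>\<^sup>i(W\<^sup>l)\<close> on the image of \<open>D\<close>.\<close>

definition torus_curvature :: "real \<Rightarrow> nat \<Rightarrow> nat \<Rightarrow> nat \<Rightarrow> nat \<Rightarrow> free_alg set" where
  "torus_curvature \<theta> i j k l =
    (let A = nc_torus \<theta>; d = torus_deriv \<theta>; D = torus_D \<theta> in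
     (\<Oplus>\<^bsub>A\<^esub>m\<in>{1..4}. (d i (D k m) \<otimes>\<^bsub>A\<^esub> d j (D m l)) \<ominus>\<^bsub>A\<^esub> (d j (D k m) \<otimes>\<^bsub>A\<^esub> d i (D m l))))"

end

theory Submission
  imports Defs
begin

text \<open>Every derivation \<open>\<partial>\<^sup>i\<close> is inner, and \<open>X\<^sup>1, X\<^sup>2\<close> commute with the entries of the first block
  of \<open>D\<close>, which are polynomials in \<open>U\<close> and \<open>U\<^sup>*\<close>; likewise for the second block. So only the case
  where \<open>k, l\<close> lie in one block and \<open>i, j\<close> in the other has to be considered. In the first block
  the nonconstant part of \<open>D\<^sup>k\<^sup>l\<close> is a combination of \<open>P = U\<^sup>*\<^sup>2\<close> and \<open>S = U\<^sup>2\<close> whose coefficients are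
  dyads of the isotropic vectors \<open>(1, \<plusminus>i)\<close>. Summing over \<open>m\<close> therefore kills the terms with two
  equal factors and leaves multiples of \<open>[X, P] [Y, S] - [Y, P] [X, S]\<close> and
  \<open>[X, S] [Y, P] - [Y, S] [X, P]\<close>. With \<open>\<tau>(x) = P x S - x\<close> (called \<open>twist\<close> below) one has \<open>[x, S] = S \<tau>(x)\<close> and
  \<open>[x, P] = - \<tau>(x) P\<close>, so that both vanish if \<open>\<tau>(X)\<close> and \<open>\<tau>(Y)\<close> commute; and \<open>\<tau>\<close> maps the commuting
  span of \<open>V\<close> and \<open>V\<^sup>*\<close> into itself.\<close>

section \<open>Weyl pairs modulo a ring congruence\<close>

abbreviation commutator :: "'a::ring \<Rightarrow> 'a \<Rightarrow> 'a" where
  "commutator x y \<equiv> x * y - y * x"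

text \<open>The congruence is the kernel \<open>h a = h b\<close> of a map rather than a relation, so that
  calculations modulo it are chains of equations.\<close>

locale ring_congruence =
  fixes h :: "'a::ring_1 \<Rightarrow> 'b"
  assumes add_cong: "h a = h b \<Longrightarrow> h c = h d \<Longrightarrow> h (a + c) = h (b + d)"
    and mult_cong: "h a = h b \<Longrightarrow> h c = h d \<Longrightarrow> h (a * c) = h (b * d)"
begin

lemma uminus_cong: "h a = h b \<Longrightarrow> h (- a) = h (- b)"
  using mult_cong[of "- 1" "- 1" a b] by simp

lemma diff_cong: "h a = h b \<Longrightarrow> h c = h d \<Longrightarrow> h (a - c) = h (b - d)"
  using add_cong[of a b "- c" "- d"] uminus_cong[of c d] by simp

lemma sum_cong: "(\<And>m. m \<in> M \<Longrightarrow> h (f m) = h (g m)) \<Longrightarrow> h (sum f M) = h (sum g M)"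
proof (induction M rule: infinite_finite_induct)
  case (insert m M)
  then have "h (f m + sum f M) = h (g m + sum g M)"
    by (intro add_cong) blast+
  with insert show ?case
    by simp
qed simp_all

lemma mult_left_cong: "h a = h b \<Longrightarrow> h (c * a) = h (c * b)"
  by (rule mult_cong) simp_all

lemma mult_right_cong: "h a = h b \<Longrightarrow> h (a * c) = h (b * c)"
  by (rule mult_cong) simp_all

lemma sandwich_cong: "h a = h b \<Longrightarrow> h (c * a * d) = h (c * b * d)"
  by (intro mult_cong refl)

end

text \<open>Scalars are elements of the ring itself and are central by true equations, so they can
  be moved by rewriting; congruence steps are reserved for the relations between generators.\<close>

locale scalar_congruence = ring_congruence h
  for h :: "'a::ring_1 \<Rightarrow> 'b" +
  fixes sc :: "'c::comm_ring_1 \<Rightarrow> 'a"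
  assumes sc_add: "sc (c + d) = sc c + sc d"
    and sc_mult: "sc (c * d) = sc c * sc d"
    and sc_one [simp]: "sc 1 = 1"
    and sc_commute: "sc c * a = a * sc c"
begin

lemma sc_zero [simp]: "sc 0 = 0"
  using sc_add[of 0 0] by simp

lemma sc_left_commute: "a * (sc c * b) = sc c * (a * b)"
  by (simp only: sc_commute[of c a] flip: mult.assoc)

lemma sc_sc: "sc c * (sc d * a) = sc (c * d) * a"
  by (simp add: sc_mult mult.assoc)

lemma sc_uminus: "sc (- c) = - sc c"
  using sc_add[of "- c" c] by (simp add: eq_neg_iff_add_eq_0)

lemma sc_diff: "sc (c - d) = sc c - sc d"
  using sc_add[of c "- d"] by (simp add: sc_uminus)

lemma sc_sum: "sc (sum f M) = (\<Sum>m\<in>M. sc (f m))"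
  by (induction M rule: infinite_finite_induct) (auto simp: sc_add)

end

text \<open>The relations hold only after applying \<open>h\<close>, as for words in a free algebra
  read modulo an ideal. The adjoints of the two unitaries enter as their inverses \<open>u'\<close>
  and \<open>v'\<close>.\<close>

locale weyl_pair = scalar_congruence h sc
  for h :: "'a::ring_1 \<Rightarrow> 'b" and sc :: "'c::comm_ring_1 \<Rightarrow> 'a" +
  fixes u u' v v' :: 'a and q q' :: 'c
  assumes uu': "h (u * u') = h 1" and u'u: "h (u' * u) = h 1"
    and vv': "h (v * v') = h 1" and v'v: "h (v' * v) = h 1"
    and qq': "q * q' = 1"
    and vu: "h (v * u) = h (sc q * u * v)"
begin

lemma q'q: "q' * q = 1"
  using qq' by (simp add: mult.commute)

lemma sc_q'_q: "sc q' * (sc q * a) = a"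
  by (simp add: sc_sc q'q)

section \<open>Conjugation by \<open>u\<close> and the twist\<close>

lemma conj_v: "h (u' * v * u) = h (sc q * v)"
proof -
  have "h (u' * v * u) = h (u' * (sc q * u * v))"
    using mult_left_cong[OF vu] by (simp add: mult.assoc)
  also have "\<dots> = h (sc q * (u' * u) * v)"
    by (simp add: mult.assoc sc_left_commute[of u'])
  also have "\<dots> = h (sc q * 1 * v)"
    by (rule sandwich_cong[OF u'u])
  finally show ?thesis
    by simp
qed

lemma conj_v': "h (u' * v' * u) = h (sc q' * v')"
proof -
  \<comment> \<open>Inserting \<open>u' * u\<close> before \<open>v'\<close>, and then
    \<open>v' * v\<close> between \<open>u'\<close> and \<open>u\<close>, creates the factor
    \<open>v * u\<close>. Trading it for \<open>sc q * u * v\<close> leaves \<open>v * v'\<close> at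
    the right end, so \<open>v'\<close> becomes \<open>sc q * (u' * v' * u)\<close>.\<close>
  have "h v' = h (1 * v' * 1)" by simp
  also have "\<dots> = h (u' * u * v' * 1)"
    by (intro mult_cong u'u[symmetric] refl)
  also have "\<dots> = h (u' * 1 * u * v')" by simp
  also have "\<dots> = h (u' * (v' * v) * u * v')"
    by (intro mult_cong v'v[symmetric] refl)
  also have "\<dots> = h (u' * v' * (v * u) * v')" by (simp add: mult.assoc)
  also have "\<dots> = h (u' * v' * (sc q * u * v) * v')"
    by (intro mult_cong vu refl)
  also have "\<dots> = h (sc q * (u' * v' * u) * (v * v'))"
    by (simp add: mult.assoc sc_left_commute[of u'] sc_left_commute[of v'])
  also have "\<dots> = h (sc q * (u' * v' * u) * 1)"
    by (intro mult_cong vv' refl)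
  finally have "h (sc q' * v') = h (sc q' * (sc q * (u' * v' * u) * 1))"
    by (rule mult_left_cong)
  then show ?thesis
    by (simp add: sc_q'_q)
qed

text \<open>The relation solved for \<open>u * v\<close> has the inverse parameter. This symmetry
  transfers every result about one pair of generators to the other, and so from one block of indices
  to the other.\<close>

lemma weyl_pair_swap: "weyl_pair h sc v v' u u' q' q"
proof unfold_locales
  have "h (sc q' * (v * u)) = h (sc q' * (sc q * u * v))"
    by (rule mult_left_cong[OF vu])
  then show "h (u * v) = h (sc q' * v * u)"
    by (simp add: mult.assoc sc_q'_q)
qed (fact uu' u'u vv' v'v q'q)+

definition twist :: "'a \<Rightarrow> 'a" where
  "twist x = u' * u' * x * (u * u) - x"

text \<open>\<open>v\<close> and \<open>v'\<close> are eigenvectors of conjugation by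
  \<open>u\<close>, with eigenvalues \<open>q\<close> and \<open>q'\<close>. Conjugating twice
  squares the eigenvalues, so \<open>twist\<close> acts diagonally on the span.\<close>

lemma twist_span:
  "h (twist (sc a * v' + sc b * v)) =
    h (sc (a * (q' * q' - 1)) * v' + sc (b * (q * q - 1)) * v)"
proof -
  have double: "h (u' * u' * y * (u * u)) = h (sc (c * c) * y)"
    if "h (u' * y * u) = h (sc c * y)" for y c
  proof -
    have "h (u' * (u' * y * u) * u) = h (u' * (sc c * y) * u)"
      by (rule sandwich_cong[OF that])
    also have "\<dots> = h (sc c * (u' * y * u))"
      by (simp add: mult.assoc sc_left_commute[of u'])
    also have "\<dots> = h (sc c * (sc c * y))"
      by (rule mult_left_cong[OF that])
    finally show ?thesis
      by (simp add: mult.assoc sc_mult)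
  qed
  have "twist (sc a * v' + sc b * v) =
      sc a * (u' * u' * v' * (u * u) - v') + sc b * (u' * u' * v * (u * u) - v)"
    by (simp add: twist_def algebra_simps sc_left_commute[of u'])
  also have "h \<dots> = h (sc a * (sc (q' * q') * v' - v') + sc b * (sc (q * q) * v - v))"
    by (intro add_cong mult_left_cong diff_cong double conj_v conj_v' refl)
  also have "sc a * (sc (q' * q') * v' - v') + sc b * (sc (q * q) * v - v) =
      sc (a * (q' * q' - 1)) * v' + sc (b * (q * q - 1)) * v"
    by (simp add: right_diff_distrib left_diff_distrib sc_diff sc_sc)
  finally show ?thesis .
qed

text \<open>After expansion only the order of \<open>v\<close> and \<open>v'\<close> in the mixed
  terms matters, and both orders give 1.\<close>

lemma span_commute:
  "h ((sc a * v' + sc b * v) * (sc c * v' + sc d * v)) =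
    h ((sc c * v' + sc d * v) * (sc a * v' + sc b * v))"
proof -
  have comm: "h (v * v') = h (v' * v)"
    by (simp add: vv' v'v)
  have expand: "(sc a * v' + sc b * v) * (sc c * v' + sc d * v) =
      sc (a * c) * (v' * v') + sc (a * d) * (v' * v) + (sc (b * c) * (v * v') + sc (b * d) * (v * v))"
    for a b c d
    by (simp add: distrib_left distrib_right mult.assoc sc_sc sc_left_commute[of v] sc_left_commute[of v'])
  have "h (sc (a * c) * (v' * v') + sc (a * d) * (v' * v) + (sc (b * c) * (v * v') + sc (b * d) * (v * v)))
     = h (sc (a * c) * (v' * v') + sc (a * d) * (v * v') + (sc (b * c) * (v' * v) + sc (b * d) * (v * v)))"
    by (intro add_cong mult_left_cong comm comm[symmetric] refl)
  then show ?thesis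
    unfolding expand by (simp add: ac_simps)
qed

lemma twist_commute:
  assumes "x = sc a * v' + sc b * v" and "y = sc c * v' + sc d * v"
  shows "h (twist x * twist y) = h (twist y * twist x)"
proof -
  have "h (twist x * twist y) =
      h ((sc (a * (q' * q' - 1)) * v' + sc (b * (q * q - 1)) * v) *
        (sc (c * (q' * q' - 1)) * v' + sc (d * (q * q - 1)) * v))"
    unfolding assms by (intro mult_cong twist_span)
  also have "\<dots> = h ((sc (c * (q' * q' - 1)) * v' + sc (d * (q * q - 1)) * v) *
      (sc (a * (q' * q' - 1)) * v' + sc (b * (q * q - 1)) * v))"
    by (rule span_commute)
  also have "\<dots> = h (twist y * twist x)"
    unfolding assms by (intro mult_cong twist_span[symmetric])
  finally show ?thesis .
qed

section \<open>Commutators with the squares of \<open>u\<close> and \<open>u'\<close>\<close>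

lemma u2u'2: "h (u * u * (u' * u')) = h 1" and u'2u2: "h (u' * u' * (u * u)) = h 1"
proof -
  have *: "h (a * a * (b * b)) = h 1" if "h (a * b) = h 1" for a b
  proof -
    have "h (a * (a * b) * b) = h (a * 1 * b)"
      by (rule sandwich_cong[OF that])
    then show ?thesis
      using that by (simp add: mult.assoc)
  qed
  show "h (u * u * (u' * u')) = h 1" "h (u' * u' * (u * u)) = h 1"
    by (intro * uu' u'u)+
qed

lemma commutator_u2: "h (commutator x (u * u)) = h (u * u * twist x)"
proof -
  have "h (u * u * twist x) = h (u * u * (u' * u') * (x * (u * u)) - u * u * x)"
    by (simp add: twist_def algebra_simps)
  also have "\<dots> = h (1 * (x * (u * u)) - u * u * x)"
    by (intro diff_cong mult_right_cong u2u'2 refl)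
  finally show ?thesis
    by simp
qed

lemma commutator_u'2: "h (commutator x (u' * u')) = h (- (twist x * (u' * u')))"
proof -
  have "h (- (twist x * (u' * u'))) = h (x * (u' * u') - (u' * u' * x) * (u * u * (u' * u')))"
    by (simp add: twist_def algebra_simps)
  also have "\<dots> = h (x * (u' * u') - (u' * u' * x) * 1)"
    by (intro diff_cong mult_left_cong u2u'2 refl)
  finally show ?thesis
    by (simp add: mult.assoc)
qed

text \<open>In the first product the squares meet in the middle and cancel, leaving
  \<open>- (twist x * twist y)\<close>; in the second they stay outside as a fixed sandwich around
  \<open>twist x * twist y\<close>. Either way, exchanging \<open>x\<close> and \<open>y\<close>
  amounts to \<open>twist_commute\<close>.\<close>

lemma commutator_exchange:
  assumes "x = sc a * v' + sc b * v" and "y = sc c * v' + sc d * v"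
  shows "h (commutator x (u' * u') * commutator y (u * u)) =
      h (commutator y (u' * u') * commutator x (u * u))" (is ?A)
    and "h (commutator x (u * u) * commutator y (u' * u')) =
      h (commutator y (u * u) * commutator x (u' * u'))" (is ?B)
proof -
  have *: "h (commutator x (u' * u') * commutator y (u * u)) = h (- (twist x * twist y))" for x y
  proof -
    have "h (commutator x (u' * u') * commutator y (u * u)) =
        h (- (twist x * (u' * u')) * (u * u * twist y))"
      by (intro mult_cong commutator_u2 commutator_u'2)
    also have "\<dots> = h (- (twist x * (u' * u' * (u * u)) * twist y))"
      by (simp add: mult.assoc)
    also have "\<dots> = h (- (twist x * 1 * twist y))"
      by (intro uminus_cong sandwich_cong u'2u2)
    finally show ?thesis
      by simp
  qed
  have **: "h (commutator x (u * u) * commutator y (u' * u')) =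
      h (- (u * u * (twist x * twist y) * (u' * u')))" for x y
    using mult_cong[OF commutator_u2 commutator_u'2] by (simp add: mult.assoc)
  note comm = twist_commute[OF assms]
  show ?A
    unfolding * by (intro uminus_cong comm)
  show ?B
    unfolding ** by (intro uminus_cong sandwich_cong comm)
qed

text \<open>\<open>g\<close> and \<open>g'\<close> are the coordinates of the \<open>X\<^sup>k\<close> with respect to \<open>U\<^sup>*\<close> and \<open>U\<close>.\<close>

lemma projector_curvature:
  fixes g g' :: "'i \<Rightarrow> 'c" and D :: "'i \<Rightarrow> 'i \<Rightarrow> 'a"
  assumes x: "x = sc a * v' + sc b * v" and y: "y = sc c * v' + sc d * v"
    and D: "\<And>k l. k \<in> M \<Longrightarrow> l \<in> M \<Longrightarrow> D k l = sc (\<delta> k l) -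
      sc e * ((sc (g k) * u' + sc (g' k) * u) * (sc (g l) * u' + sc (g' l) * u))"
    and g: "(\<Sum>m\<in>M. g m * g m) = 0" and g': "(\<Sum>m\<in>M. g' m * g' m) = 0"
    and k: "k \<in> M" and l: "l \<in> M"
  shows "h (\<Sum>m\<in>M. commutator x (D k m) * commutator y (D m l)
      - commutator y (D k m) * commutator x (D m l)) = h 0"
proof -
  let ?p = "u' * u'" and ?s = "u * u"
  \<comment> \<open>The mixed products \<open>u' * u\<close> and \<open>u * u'\<close> collapse to
    1, so an entry is a scalar plus a combination of the two squares.\<close>
  have D': "h (D k l) = h (sc (\<delta> k l - e * (g k * g' l + g' k * g l)) -
      (sc (e * g k * g l) * ?p + sc (e * g' k * g' l) * ?s))"
    if "k \<in> M" "l \<in> M" for k l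
  proof -
    have "D k l = sc (\<delta> k l) - (sc (e * g k * g' l) * (u' * u) + sc (e * g' k * g l) * (u * u')) -
        (sc (e * g k * g l) * ?p + sc (e * g' k * g' l) * ?s)"
      by (simp add: D[OF that] distrib_left distrib_right mult.assoc sc_sc
          sc_left_commute[of u] sc_left_commute[of u'])
    also have "h \<dots> = h (sc (\<delta> k l) - (sc (e * g k * g' l) * 1 + sc (e * g' k * g l) * 1) -
        (sc (e * g k * g l) * ?p + sc (e * g' k * g' l) * ?s))"
      by (intro diff_cong add_cong mult_left_cong u'u uu' refl)
    finally show ?thesis
      by (simp add: distrib_left mult.assoc sc_add sc_diff)
  qed
  \<comment> \<open>The scalar part is central and drops out of the commutator.\<close>
  have comm: "h (commutator z (D k l)) =
      h (- (sc (e * g k * g l) * commutator z ?p + sc (e * g' k * g' l) * commutator z ?s))"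
    if "k \<in> M" "l \<in> M" for k l z
  proof -
    have *: "commutator z (sc A - (sc B * p + sc C * s)) =
       - (sc B * commutator z p + sc C * commutator z s)" for A B C p s
      by (simp add: distrib_left distrib_right left_diff_distrib right_diff_distrib mult.assoc
          sc_left_commute[of z] sc_commute[of _ z, symmetric])
    have "h (commutator z (D k l)) =
        h (commutator z (sc (\<delta> k l - e * (g k * g' l + g' k * g l)) -
          (sc (e * g k * g l) * ?p + sc (e * g' k * g' l) * ?s)))"
      by (intro diff_cong mult_cong D' that refl)
    then show ?thesis
      unfolding * .
  qed
  \<comment> \<open>The terms mixing the two squares cancel for each single \<open>m\<close> by
    \<open>commutator_exchange\<close>. What remains has a coefficient containing
    \<open>g m * g m\<close> or \<open>g' m * g' m\<close>.\<close>
  have summand: "h (commutator x (D k m) * commutator y (D m l)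
        - commutator y (D k m) * commutator x (D m l)) =
      h (sc (e * e * g k * g l * (g m * g m)) * commutator (commutator x ?p) (commutator y ?p)
        + sc (e * e * g' k * g' l * (g' m * g' m)) * commutator (commutator x ?s) (commutator y ?s))"
    if m: "m \<in> M" for m
  proof -
    let ?B = "sc (e * g k * g m)" and ?C = "sc (e * g' k * g' m)"
      and ?B' = "sc (e * g m * g l)" and ?C' = "sc (e * g' m * g' l)"
    have expand: "(- (sc B * xp + sc C * xs)) * (- (sc B' * yp + sc C' * ys))
        - (- (sc B * yp + sc C * ys)) * (- (sc B' * xp + sc C' * xs)) =
      sc (B * B') * commutator xp yp + sc (C * C') * commutator xs ys
      + (sc (B * C') * (xp * ys - yp * xs) + sc (C * B') * (xs * yp - ys * xp))"
      for xp xs yp ys B C B' C'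
      by (simp add: distrib_left distrib_right left_diff_distrib right_diff_distrib mult.assoc sc_sc
          sc_left_commute[of xp] sc_left_commute[of xs]
          sc_left_commute[of yp] sc_left_commute[of ys])
    have zero: "h (a - b) = h 0" if "h a = h b" for a b
      using diff_cong[OF that refl[of "h b"]] by simp
    have "h (commutator x (D k m) * commutator y (D m l)
        - commutator y (D k m) * commutator x (D m l)) =
      h ((- (?B * commutator x ?p + ?C * commutator x ?s)) * (- (?B' * commutator y ?p + ?C' * commutator y ?s))
        - (- (?B * commutator y ?p + ?C * commutator y ?s)) * (- (?B' * commutator x ?p + ?C' * commutator x ?s)))"
      by (intro diff_cong mult_cong comm k l m)
    also have "\<dots> = h (sc (e * g k * g m * (e * g m * g l)) * commutator (commutator x ?p) (commutator y ?p)
        + sc (e * g' k * g' m * (e * g' m * g' l)) * commutator (commutator x ?s) (commutator y ?s)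
        + (sc (e * g k * g m * (e * g' m * g' l)) * 0 + sc (e * g' k * g' m * (e * g m * g l)) * 0))"
      unfolding expand
      by (intro add_cong mult_left_cong refl zero commutator_exchange[OF x y])
    also have "e * g k * g m * (e * g m * g l) = e * e * g k * g l * (g m * g m)"
      by (simp add: ac_simps)
    also have "e * g' k * g' m * (e * g' m * g' l) = e * e * g' k * g' l * (g' m * g' m)"
      by (simp add: ac_simps)
    finally show ?thesis
      by (simp only: mult_zero_right add_0_right)
  qed
  have "h (\<Sum>m\<in>M. commutator x (D k m) * commutator y (D m l)
      - commutator y (D k m) * commutator x (D m l)) =
    h (\<Sum>m\<in>M. sc (e * e * g k * g l * (g m * g m)) * commutator (commutator x ?p) (commutator y ?p)
        + sc (e * e * g' k * g' l * (g' m * g' m)) * commutator (commutator x ?s) (commutator y ?s))"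
    by (intro sum_cong summand)
  \<comment> \<open>The commutators do not depend on \<open>m\<close>, so the sum moves into the
    coefficients, where isotropy makes it zero.\<close>
  also have "\<dots> = h (sc (e * e * g k * g l * (\<Sum>m\<in>M. g m * g m)) * commutator (commutator x ?p) (commutator y ?p)
        + sc (e * e * g' k * g' l * (\<Sum>m\<in>M. g' m * g' m)) * commutator (commutator x ?s) (commutator y ?s))"
    by (simp only: sum.distrib sum_distrib_left sum_distrib_right sc_sum)
  finally show ?thesis
    by (simp add: g g')
qed

text \<open>\<open>x\<close> and both factors in \<open>D\<close> lie in the span of
  \<open>u'\<close> and \<open>u\<close>, whose elements commute modulo \<open>h\<close>.\<close>

lemma projector_commute:
  assumes D: "D = sc \<delta> - sc e * ((sc a * u' + sc b * u) * (sc c * u' + sc d * u))"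
    and x: "x = sc a' * u' + sc b' * u"
  shows "h (commutator x D) = h 0"
proof -
  \<comment> \<open>\<open>span_commute\<close> speaks of the second pair of generators, hence the
    exchange.\<close>
  interpret swap: weyl_pair h sc v v' u u' q' q
    by (rule weyl_pair_swap)
  let ?y = "sc a * u' + sc b * u" and ?z = "sc c * u' + sc d * u"
  have "h (x * (?y * ?z)) = h (?y * x * ?z)"
    unfolding x mult.assoc[symmetric] by (intro mult_right_cong swap.span_commute)
  also have "\<dots> = h (?y * ?z * x)"
    unfolding x mult.assoc by (intro mult_left_cong swap.span_commute)
  finally have "h (sc e * (?y * ?z * x - x * (?y * ?z))) = h (sc e * (?y * ?z * x - ?y * ?z * x))"
    by (intro mult_left_cong diff_cong refl)
  moreover have "commutator x (sc \<delta> - sc e * w) = sc e * (w * x - x * w)" for w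
    by (simp add: left_diff_distrib right_diff_distrib mult.assoc
        sc_left_commute[of x] sc_commute[of _ x, symmetric])
  ultimately show ?thesis
    unfolding D by simp
qed

text \<open>\<open>M\<close> is the index block of \<open>u\<close> and \<open>N\<close> that of
  \<open>v\<close>. The row index \<open>k\<close> is fixed in \<open>M\<close>; rows in
  \<open>N\<close> are reached by exchanging the pairs.\<close>

lemma curvature_vanishes:
  fixes g g' :: "'i \<Rightarrow> 'c" and x :: "'i \<Rightarrow> 'a" and D :: "'i \<Rightarrow> 'i \<Rightarrow> 'a"
  assumes XM: "\<And>k. k \<in> M \<Longrightarrow> x k = sc (g k) * u' + sc (g' k) * u"
    and XN: "\<And>k. k \<in> N \<Longrightarrow> x k = sc (g k) * v' + sc (g' k) * v"
    and D: "\<And>k l. k \<in> M \<Longrightarrow> l \<in> M \<Longrightarrow> D k l = sc (\<delta> k l) - sc e * (x k * x l)"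
    and D0: "\<And>k l. k \<in> M \<Longrightarrow> l \<in> N \<Longrightarrow> D k l = 0" "\<And>k l. k \<in> M \<Longrightarrow> l \<in> N \<Longrightarrow> D l k = 0"
    and g: "(\<Sum>m\<in>M. g m * g m) = 0" and g': "(\<Sum>m\<in>M. g' m * g' m) = 0"
    and MN: "finite M" "finite N" "M \<inter> N = {}"
    and i: "i \<in> M \<union> N" and j: "j \<in> M \<union> N" and k: "k \<in> M" and l: "l \<in> M \<union> N"
  shows "h (\<Sum>m\<in>M \<union> N. commutator (x i) (D k m) * commutator (x j) (D m l)
      - commutator (x j) (D k m) * commutator (x i) (D m l)) = h 0"
proof -
  let ?S = "\<lambda>m. commutator (x i) (D k m) * commutator (x j) (D m l)
      - commutator (x j) (D k m) * commutator (x i) (D m l)"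
  \<comment> \<open>For \<open>m\<close> in \<open>N\<close> the entry \<open>D k m\<close> is off
    the diagonal blocks and vanishes.\<close>
  have "(\<Sum>m\<in>M \<union> N. ?S m) = (\<Sum>m\<in>M. ?S m)"
    using MN k by (intro sum.mono_neutral_right) (auto simp: D0)
  moreover have "h (\<Sum>m\<in>M. ?S m) = h 0"
  \<comment> \<open>This is the only case with genuine cancellation between terms; in all others
    each product vanishes by itself.\<close>
  proof (cases "l \<in> M \<and> i \<in> N \<and> j \<in> N")
    case True
    then show ?thesis
      using k by (intro projector_curvature[OF XN XN _ g g']) (auto simp: D XM)
  next
    case False
    have comm: "h (commutator (x n) (D p m)) = h 0" if "n \<in> M" "p \<in> M" "m \<in> M" for n p m
      using that by (intro projector_commute[OF _ XM]) (auto simp: D XM)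
    have "h (?S m) = h 0" if m: "m \<in> M" for m
    proof (cases "l \<in> M")
      case False
      then show ?thesis
        using l m by (simp add: D0)
    next
      case lM: True
      with False i j consider "i \<in> M" | "j \<in> M"
        by blast
      \<comment> \<open>Each product has one commutator with \<open>x i\<close> and one with
        \<open>x j\<close>. Whichever of the two indices lies in \<open>M\<close> yields a factor
        congruent to 0.\<close>
      then have "h (commutator (x i) (D k m) * commutator (x j) (D m l)) = h 0"
        and "h (commutator (x j) (D k m) * commutator (x i) (D m l)) = h 0"
        using mult_right_cong[OF comm[OF _ k m]] mult_left_cong[OF comm[OF _ m lM]]
        by (metis mult_zero_left mult_zero_right)+
      then show ?thesis
        using diff_cong[of _ 0 _ 0] by simp
    qed
    then have "h (\<Sum>m\<in>M. ?S m) = h (\<Sum>m\<in>M. 0)"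
      by (rule sum_cong)
    then show ?thesis
      by simp
  qed
  ultimately show ?thesis
    by simp
qed

end

section \<open>The involution on the free algebra\<close>

lemma letter_adj_letter_adj [simp]: "letter_adj (letter_adj x) = x"
  by (cases x) auto

lemma word_adj_word_adj [simp]: "word_adj (word_adj w) = w"
  by (cases w) (simp add: word_adj_def rev_map o_def)

lemma word_adj_add: "word_adj (v + w) = word_adj w + word_adj v"
  by (simp add: word_adj_def plus_word_def)

text \<open>\<open>word_adj\<close> is an involution, so exactly one word can contribute to a given
  coefficient. Identities for \<open>free_adj\<close> can then be checked coefficientwise.\<close>

lemma lookup_free_adj:
  "Poly_Mapping.lookup (free_adj p) w = cnj (Poly_Mapping.lookup p (word_adj w))"
proof -
  have "Poly_Mapping.lookup (free_adj p) w =
      (\<Sum>x\<in>Poly_Mapping.keys p. if x = word_adj w then cnj (Poly_Mapping.lookup p x) else 0)"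
    unfolding free_adj_def lookup_sum lookup_single
    by (intro sum.cong refl) (auto simp: when_def)
  also have "\<dots> = cnj (Poly_Mapping.lookup p (word_adj w))"
    by (simp add: in_keys_iff)
  finally show ?thesis .
qed

lemma free_adj_add: "free_adj (a + b) = free_adj a + free_adj b"
  by (rule poly_mapping_eqI) (simp add: lookup_free_adj lookup_add)

lemma free_adj_zero [simp]: "free_adj 0 = 0"
  by (rule poly_mapping_eqI) (simp add: lookup_free_adj)

lemma free_adj_uminus: "free_adj (- a) = - free_adj a"
  by (metis free_adj_add free_adj_zero add_eq_0_iff)

lemma free_adj_free_adj [simp]: "free_adj (free_adj a) = a"
  by (rule poly_mapping_eqI) (simp add: lookup_free_adj)

lemma free_adj_single:
  "free_adj (Poly_Mapping.single w c) = Poly_Mapping.single (word_adj w) (cnj c)"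
  by (simp add: free_adj_def)

lemma free_adj_gen: "free_adj (gen x) = gen (letter_adj x)"
  by (simp add: gen_def free_adj_single word_adj_def)

text \<open>An element is the finite sum of its monomials, so additive identities reduce to single
  words.\<close>

lemma free_alg_induct:
  fixes p :: free_alg
  assumes "P 0" and "\<And>w c. P (Poly_Mapping.single w c)"
    and "\<And>p q. P p \<Longrightarrow> P q \<Longrightarrow> P (p + q)"
  shows "P p"
proof -
  have "P (\<Sum>w\<in>W. Poly_Mapping.single w (Poly_Mapping.lookup p w))" if "finite W" for W
    using that by (induction W) (auto intro: assms)
  from this[of "Poly_Mapping.keys p"]
  have "P (\<Sum>w\<in>Poly_Mapping.keys p. Poly_Mapping.single w (Poly_Mapping.lookup p w))"
    by simp
  also have "(\<Sum>w\<in>Poly_Mapping.keys p. Poly_Mapping.single w (Poly_Mapping.lookup p w)) = p"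
    by (rule poly_mapping_eqI) (simp add: lookup_sum lookup_single when_def in_keys_iff)
  finally show ?thesis .
qed

lemma free_adj_mult: "free_adj (a * b) = free_adj b * free_adj a"
proof (induction a rule: free_alg_induct)
  case (2 w c)
  show ?case
    by (induction b rule: free_alg_induct)
      (simp_all add: free_adj_single mult_single word_adj_add free_adj_add algebra_simps)
qed (simp_all add: free_adj_add algebra_simps)

lemma scalar_add: "scalar (c + d) = scalar c + scalar d"
  by (simp add: scalar_def single_add)

lemma scalar_mult: "scalar (c * d) = scalar c * scalar d"
  by (simp add: scalar_def mult_single)

lemma scalar_one [simp]: "scalar 1 = 1"
  by (simp add: scalar_def)

lemma scalar_commute: "scalar c * a = a * scalar c"
  by (induction a rule: free_alg_induct)
    (simp_all add: scalar_def mult_single algebra_simps)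

section \<open>Cosets of the defining ideal\<close>

lemma free_ring_simps [simp]:
  "carrier free_ring = UNIV" "a \<otimes>\<^bsub>free_ring\<^esub> b = a * b" "a \<oplus>\<^bsub>free_ring\<^esub> b = a + b"
  "\<zero>\<^bsub>free_ring\<^esub> = 0" "\<one>\<^bsub>free_ring\<^esub> = 1"
  by (simp_all add: ring_of_type_algebra_def)

lemma ring_free_ring: "ring free_ring"
proof -
  have "\<exists>y. x + y = 0" for x :: free_alg
    using add.right_inverse by blast
  then show ?thesis
    unfolding ring_of_type_algebra_def using add.right_inverse
    by unfold_locales (auto simp: algebra_simps Units_def)
qed

interpretation free: ring free_ring
  by (rule ring_free_ring)

lemma free_ring_uminus [simp]: "\<ominus>\<^bsub>free_ring\<^esub> a = - a"
  by (rule free.minus_equality) simp_all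

lemma torus_ideal: "ideal (torus_ideal \<theta>) free_ring"
  unfolding torus_ideal_def by (rule free.genideal_ideal) simp

lemma torus_ideal_zero: "0 \<in> torus_ideal \<theta>"
  using additive_subgroup.zero_closed[OF ideal.axioms(1)[OF torus_ideal]] by simp

lemma torus_ideal_add:
  "a \<in> torus_ideal \<theta> \<Longrightarrow> b \<in> torus_ideal \<theta> \<Longrightarrow> a + b \<in> torus_ideal \<theta>"
  using additive_subgroup.a_closed[OF ideal.axioms(1)[OF torus_ideal]] by simp

lemma torus_ideal_mult_left: "a \<in> torus_ideal \<theta> \<Longrightarrow> x * a \<in> torus_ideal \<theta>"
  using ideal.I_l_closed[OF torus_ideal] by simp

lemma torus_ideal_mult_right: "a \<in> torus_ideal \<theta> \<Longrightarrow> a * x \<in> torus_ideal \<theta>"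
  using ideal.I_r_closed[OF torus_ideal] by simp

lemma torus_ideal_uminus: "a \<in> torus_ideal \<theta> \<Longrightarrow> - a \<in> torus_ideal \<theta>"
  using torus_ideal_mult_left[of a \<theta> "- 1"] by simp

lemma torus_ideal_subgroup: "abelian_subgroup (torus_ideal \<theta>) free_ring"
  using ideal.axioms(1)[OF torus_ideal] free.abelian_group_axioms
  by (rule abelian_subgroupI3)

text \<open>The quotient map onto the torus; it serves as the map \<open>h\<close> of the congruence
  locales.\<close>

definition torus_class :: "real \<Rightarrow> free_alg \<Rightarrow> free_alg set" where
  "torus_class \<theta> a = torus_ideal \<theta> +>\<^bsub>free_ring\<^esub> a"

lemma mem_torus_class: "b \<in> torus_class \<theta> a \<longleftrightarrow> b - a \<in> torus_ideal \<theta>"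
  using abelian_subgroup.a_rcos_module[OF torus_ideal_subgroup, of a b \<theta>] by (simp add: torus_class_def)

lemma torus_class_self: "a \<in> torus_class \<theta> a"
  using torus_ideal_zero[of \<theta>] by (simp add: mem_torus_class)

lemma torus_class_eq_iff: "torus_class \<theta> a = torus_class \<theta> b \<longleftrightarrow> a - b \<in> torus_ideal \<theta>"
  using abelian_subgroup.a_repr_independence'[OF torus_ideal_subgroup, of a \<theta> b]
    torus_class_self
  by (metis torus_class_def mem_torus_class UNIV_I free_ring_simps(1))

lemma torus_ideal_subset:
  "torus_relators \<theta> \<union> free_adj ` torus_relators \<theta> \<subseteq> torus_ideal \<theta>"
  unfolding torus_ideal_def by (rule free.genideal_self) simp

text \<open>The preimage of the ideal under \<open>free_adj\<close> is again a two-sided ideal, with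
  left and right absorption exchanged. It contains the generators because their set is closed under
  the involution, so minimality of the generated ideal applies.\<close>

lemma torus_ideal_free_adj:
  assumes "a \<in> torus_ideal \<theta>"
  shows "free_adj a \<in> torus_ideal \<theta>"
proof -
  let ?J = "{a. free_adj a \<in> torus_ideal \<theta>}"
  have "ideal ?J free_ring"
  proof (rule idealI[OF ring_free_ring])
    have inv: "inv\<^bsub>add_monoid free_ring\<^esub> a = - a" for a
      by (metis a_inv_def free_ring_uminus)
    show "subgroup ?J (add_monoid free_ring)"
    proof (rule group.subgroupI[OF free.a_group])
      show "?J \<noteq> {}"
        using torus_ideal_zero[of \<theta>] by (auto intro!: exI[of _ 0])
    next
      fix a assume "a \<in> ?J"
      then show "inv\<^bsub>add_monoid free_ring\<^esub> a \<in> ?J"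
        using torus_ideal_uminus[of "free_adj a" \<theta>]
        by (simp only: inv mem_Collect_eq free_adj_uminus)
    next
      fix a b assume "a \<in> ?J" "b \<in> ?J"
      then show "a \<otimes>\<^bsub>add_monoid free_ring\<^esub> b \<in> ?J"
        using torus_ideal_add[of "free_adj a" \<theta> "free_adj b"] by (simp add: free_adj_add)
    qed simp
  next
    fix a x :: free_alg assume "a \<in> ?J"
    then show "x \<otimes>\<^bsub>free_ring\<^esub> a \<in> ?J" "a \<otimes>\<^bsub>free_ring\<^esub> x \<in> ?J"
      using torus_ideal_mult_left[of "free_adj a" \<theta> "free_adj x"]
        torus_ideal_mult_right[of "free_adj a" \<theta> "free_adj x"]
      by (simp_all add: free_adj_mult)
  qed
  moreover have "torus_relators \<theta> \<union> free_adj ` torus_relators \<theta> \<subseteq> ?J"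
    using torus_ideal_subset[of \<theta>] by auto
  ultimately have "torus_ideal \<theta> \<subseteq> ?J"
    unfolding torus_ideal_def by (rule free.genideal_minimal)
  then show ?thesis
    using assms by blast
qed

section \<open>The torus operations on representatives\<close>

lemma adj_torus_class: "adj (nc_torus \<theta>) (torus_class \<theta> a) = torus_class \<theta> (free_adj a)"
proof -
  have *: "free_adj b \<in> torus_class \<theta> (free_adj a)" if "b \<in> torus_class \<theta> a" for a b
    using that torus_ideal_free_adj[of "b - a" \<theta>]
    by (simp add: mem_torus_class diff_conv_add_uminus free_adj_add free_adj_uminus
        del: add_uminus_conv_diff)
  \<comment> \<open>One inclusion is \<open>*\<close>; the other is \<open>*\<close> for the adjoint
    coset, with witness \<open>free_adj b\<close>, since \<open>free_adj\<close> is its own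
    inverse.\<close>
  have "free_adj ` torus_class \<theta> a = torus_class \<theta> (free_adj a)"
  proof (intro antisym subsetI)
    fix b assume "b \<in> torus_class \<theta> (free_adj a)"
    then show "b \<in> free_adj ` torus_class \<theta> a"
      using *[of b "free_adj a"] by (intro image_eqI[of _ _ "free_adj b"]) simp_all
  qed (use * in blast)
  then show ?thesis
    by (simp add: nc_torus_def Let_def)
qed

lemma nc_torus_zero: "\<zero>\<^bsub>nc_torus \<theta>\<^esub> = torus_class \<theta> 0"
  using abelian_subgroup.a_rcos_const[OF torus_ideal_subgroup torus_ideal_zero]
  by (simp add: nc_torus_def Let_def FactRing_def torus_class_def)

lemma nc_torus_one: "\<one>\<^bsub>nc_torus \<theta>\<^esub> = torus_class \<theta> 1"
  by (simp add: nc_torus_def Let_def FactRing_def torus_class_def)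

lemma nc_torus_add:
  "torus_class \<theta> a \<oplus>\<^bsub>nc_torus \<theta>\<^esub> torus_class \<theta> b = torus_class \<theta> (a + b)"
  using abelian_subgroup.a_rcos_sum[OF torus_ideal_subgroup, of a b \<theta>]
  by (simp add: nc_torus_def Let_def FactRing_def torus_class_def)

lemma nc_torus_mult:
  "torus_class \<theta> a \<otimes>\<^bsub>nc_torus \<theta>\<^esub> torus_class \<theta> b = torus_class \<theta> (a * b)"
  using ideal.rcoset_mult_add[OF torus_ideal, of a b \<theta>]
  by (simp add: nc_torus_def Let_def FactRing_def torus_class_def)

lemma nc_torus_smult:
  "c \<odot>\<^bsub>nc_torus \<theta>\<^esub> torus_class \<theta> a = torus_class \<theta> (scalar c * a)"
proof -
  \<comment> \<open>All cosets in the union defining the scalar action coincide, because the ideal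
    absorbs scalars.\<close>
  have "torus_class \<theta> (scalar c * b) = torus_class \<theta> (scalar c * a)" if "b \<in> torus_class \<theta> a" for b
    using that torus_ideal_mult_left[of "b - a" \<theta> "scalar c"]
    by (simp add: mem_torus_class torus_class_eq_iff algebra_simps)
  then have "(\<Union>b\<in>torus_class \<theta> a. torus_class \<theta> (scalar c * b)) = torus_class \<theta> (scalar c * a)"
    using torus_class_self by blast
  then show ?thesis
    by (simp add: nc_torus_def Let_def torus_class_def)
qed

lemma carrier_nc_torus: "carrier (nc_torus \<theta>) = range (torus_class \<theta>)"
  by (auto simp: nc_torus_def Let_def FactRing_def A_RCOSETS_def RCOSETS_def torus_class_def
      a_r_coset_def)

text \<open>This makes the general facts on differences and finite sums available for the record
  \<open>nc_torus\<close>.\<close>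

lemma abelian_group_nc_torus: "abelian_group (nc_torus \<theta>)"
proof (rule abelian_groupI)
  fix A assume "A \<in> carrier (nc_torus \<theta>)"
  then obtain a where "A = torus_class \<theta> a"
    by (auto simp: carrier_nc_torus)
  then show "\<exists>B\<in>carrier (nc_torus \<theta>). B \<oplus>\<^bsub>nc_torus \<theta>\<^esub> A = \<zero>\<^bsub>nc_torus \<theta>\<^esub>"
    by (intro bexI[of _ "torus_class \<theta> (- a)"])
      (simp_all add: carrier_nc_torus nc_torus_add nc_torus_zero)
qed (auto simp: carrier_nc_torus nc_torus_add nc_torus_zero ac_simps)

lemma nc_torus_minus:
  "torus_class \<theta> a \<ominus>\<^bsub>nc_torus \<theta>\<^esub> torus_class \<theta> b = torus_class \<theta> (a - b)"
proof -
  interpret abelian_group "nc_torus \<theta>"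
    by (rule abelian_group_nc_torus)
  have "\<ominus>\<^bsub>nc_torus \<theta>\<^esub> torus_class \<theta> b = torus_class \<theta> (- b)"
    by (rule minus_equality) (simp_all add: carrier_nc_torus nc_torus_add nc_torus_zero)
  then show ?thesis
    by (simp add: a_minus_def nc_torus_add)
qed

lemma nc_torus_finsum:
  assumes "finite M"
  shows "(\<Oplus>\<^bsub>nc_torus \<theta>\<^esub>m\<in>M. torus_class \<theta> (f m)) = torus_class \<theta> (\<Sum>m\<in>M. f m)"
proof -
  interpret abelian_group "nc_torus \<theta>"
    by (rule abelian_group_nc_torus)
  show ?thesis
    using assms
    by induction (simp_all add: nc_torus_zero carrier_nc_torus nc_torus_add)
qed

lemmas nc_torus_simps =
  nc_torus_zero nc_torus_one nc_torus_add nc_torus_mult nc_torus_smult nc_torus_minus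
  adj_torus_class

section \<open>Vanishing of the curvature\<close>

definition torus_coord :: "nat \<Rightarrow> complex" where
  "torus_coord k = (if k = 1 \<or> k = 3 then 1 else \<i>) * complex_of_real (1 / (2 * sqrt 2))"

definition torus_coord' :: "nat \<Rightarrow> complex" where
  "torus_coord' k = (if k = 1 \<or> k = 3 then 1 else - \<i>) * complex_of_real (1 / (2 * sqrt 2))"

text \<open>A lift of the coordinate in the normal form required by
  \<open>curvature_vanishes\<close>: a multiple of the adjoint generator plus a multiple of the
  generator.\<close>

definition free_X :: "nat \<Rightarrow> free_alg" where
  "free_X k = (if k = 1 \<or> k = 2
     then scalar (torus_coord k) * gen LUadj + scalar (torus_coord' k) * gen LU
     else scalar (torus_coord k) * gen LVadj + scalar (torus_coord' k) * gen LV)"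

definition free_D :: "nat \<Rightarrow> nat \<Rightarrow> free_alg" where
  "free_D k l = scalar (if k = l then 1 else 0) -
    (if k \<in> {1, 2} \<and> l \<in> {1, 2} \<or> k \<in> {3, 4} \<and> l \<in> {3, 4}
     then scalar 2 * (free_X k * free_X l) else 0)"

interpretation scalar: scalar_congruence "torus_class \<theta>" scalar for \<theta>
proof unfold_locales
  fix a b c d
  assume *: "torus_class \<theta> a = torus_class \<theta> b" "torus_class \<theta> c = torus_class \<theta> d"
  show "torus_class \<theta> (a + c) = torus_class \<theta> (b + d)"
    by (simp add: * flip: nc_torus_add)
  show "torus_class \<theta> (a * c) = torus_class \<theta> (b * d)"
    by (simp add: * flip: nc_torus_mult)
qed (fact scalar_add scalar_mult scalar_one scalar_commute)+

lemma torus_weyl_pair: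
  "weyl_pair (torus_class \<theta>) scalar (gen LU) (gen LUadj) (gen LV) (gen LVadj)
    (torus_q \<theta>) (inverse (torus_q \<theta>))"
proof unfold_locales
  show "torus_class \<theta> (gen LV * gen LU) = torus_class \<theta> (scalar (torus_q \<theta>) * gen LU * gen LV)"
    "torus_class \<theta> (gen LU * gen LUadj) = torus_class \<theta> 1"
    "torus_class \<theta> (gen LUadj * gen LU) = torus_class \<theta> 1"
    "torus_class \<theta> (gen LV * gen LVadj) = torus_class \<theta> 1"
    "torus_class \<theta> (gen LVadj * gen LV) = torus_class \<theta> 1"
    using torus_ideal_subset[of \<theta>] by (auto simp: torus_class_eq_iff torus_relators_def)
qed (simp add: torus_q_def)

lemma torus_X_eq: "torus_X \<theta> i = torus_class \<theta> (free_X i)"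
proof -
  have "torus_U \<theta> = torus_class \<theta> (gen LU)" "torus_V \<theta> = torus_class \<theta> (gen LV)"
    by (simp_all add: torus_U_def torus_V_def torus_class_def)
  then show ?thesis
    by (auto simp: torus_X_def Let_def nc_torus_simps free_adj_gen free_X_def torus_coord_def
        torus_coord'_def scalar.sc_uminus right_diff_distrib distrib_left)
qed

lemma torus_D_eq: "torus_D \<theta> k l = torus_class \<theta> (free_D k l)"
  by (auto simp add: torus_D_def torus_Pi_def Let_def torus_X_eq nc_torus_simps free_D_def)

lemma torus_deriv_eq:
  "torus_deriv \<theta> i (torus_class \<theta> a) =
    torus_class \<theta> (scalar (1 / (\<i> * complex_of_real (torus_hbar \<theta>))) * commutator (free_X i) a)"
  by (simp add: torus_deriv_def Let_def torus_X_eq nc_torus_simps)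

text \<open>Each term contains two derivations, hence the square of their common central prefactor.
  Pulling it out leaves the sum of commutator products treated abstractly above.\<close>

lemma torus_curvature_eq:
  "torus_curvature \<theta> i j k l = torus_class \<theta>
    (scalar ((1 / (\<i> * complex_of_real (torus_hbar \<theta>)))\<^sup>2) *
      (\<Sum>m\<in>{1..4}. commutator (free_X i) (free_D k m) * commutator (free_X j) (free_D m l)
        - commutator (free_X j) (free_D k m) * commutator (free_X i) (free_D m l)))"
proof -
  have pull: "scalar c * a * (scalar c * b) - scalar c * a' * (scalar c * b') =
      scalar (c\<^sup>2) * (a * b - a' * b')" for a b a' b' c
    by (simp add: right_diff_distrib mult.assoc scalar.sc_sc power2_eq_square
        scalar.sc_left_commute[of a] scalar.sc_left_commute[of a'])
  show ?thesis
    unfolding torus_curvature_def Let_def torus_D_eq torus_deriv_eq nc_torus_mult nc_torus_minus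
    by (simp only: nc_torus_finsum[OF finite_atLeastAtMost] pull sum_distrib_left)
qed

theorem proposition5p1:
  fixes \<theta> :: real
  assumes "cos \<theta> \<noteq> 0" and "torus_hbar \<theta> \<noteq> 0"
  shows "\<forall>i\<in>{1..4}. \<forall>j\<in>{1..4}. \<forall>k\<in>{1..4}. \<forall>l\<in>{1..4}.
           torus_curvature \<theta> i j k l = \<zero>\<^bsub>nc_torus \<theta>\<^esub>"
proof (intro ballI)
  fix i j k l :: nat
  assume ijkl: "i \<in> {1..4}" "j \<in> {1..4}" "k \<in> {1..4}" "l \<in> {1..4}"
  let ?S = "\<Sum>m\<in>{1..4}. commutator (free_X i) (free_D k m) * commutator (free_X j) (free_D m l)
        - commutator (free_X j) (free_D k m) * commutator (free_X i) (free_D m l)"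
  \<comment> \<open>Two orderings of the blocks, since the block containing \<open>k\<close> has to
    come first.\<close>
  have indices: "{1..4} = {1, 2} \<union> {3, 4::nat}" "{1..4} = {3, 4} \<union> {1, 2::nat}"
    by auto
  interpret UV: weyl_pair "torus_class \<theta>" scalar "gen LU" "gen LUadj" "gen LV" "gen LVadj"
    "torus_q \<theta>" "inverse (torus_q \<theta>)"
    by (rule torus_weyl_pair)
  interpret VU: weyl_pair "torus_class \<theta>" scalar "gen LV" "gen LVadj" "gen LU" "gen LUadj"
    "inverse (torus_q \<theta>)" "torus_q \<theta>"
    by (rule UV.weyl_pair_swap)
  \<comment> \<open>With \<open>r\<close> the common real factor, each sum is \<open>r^2\<close>
    plus the square of \<open>i r\<close> or of \<open>- i r\<close>, which is 0.\<close>
  have isotropic: "(\<Sum>m\<in>M. torus_coord m * torus_coord m) = 0"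
    "(\<Sum>m\<in>M. torus_coord' m * torus_coord' m) = 0" if "M = {1, 2} \<or> M = {3, 4}" for M
    using that by (auto simp: torus_coord_def torus_coord'_def)
  have D: "free_D a b = scalar (if a = b then 1 else 0) - scalar 2 * (free_X a * free_X b)"
    if "a \<in> M" "b \<in> M" "M = {1, 2} \<or> M = {3, 4}" for a b M
    using that unfolding free_D_def by (intro arg_cong2[of _ _ _ _ minus] refl if_P) blast
  have D0: "free_D a b = 0" "free_D b a = 0" if "a \<in> {1, 2}" "b \<in> {3, 4}" for a b
    using that by (elim insertE emptyE; simp add: free_D_def)+
  have "torus_class \<theta> ?S = torus_class \<theta> 0"
  proof (cases "k \<in> {1, 2}")
    case True
    show ?thesis
      unfolding indices(1)
    proof (rule UV.curvature_vanishes[of _ free_X torus_coord torus_coord'])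
      show "free_D a b = scalar (if a = b then 1 else 0) - scalar 2 * (free_X a * free_X b)"
        if "a \<in> {1, 2}" "b \<in> {1, 2}" for a b
        using that by (intro D[of _ "{1, 2}"]) simp_all
    qed (use True ijkl D0 isotropic in \<open>auto simp: free_X_def\<close>)
  next
    case False
    then have k: "k \<in> {3, 4}"
      using ijkl by auto
    \<comment> \<open>The second block is the first one for the exchanged Weyl pair.\<close>
    show ?thesis
      unfolding indices(2)
    proof (rule VU.curvature_vanishes[of _ free_X torus_coord torus_coord'])
      show "free_D a b = scalar (if a = b then 1 else 0) - scalar 2 * (free_X a * free_X b)"
        if "a \<in> {3, 4}" "b \<in> {3, 4}" for a b
        using that by (intro D[of _ "{3, 4}"]) simp_all
    qed (use k ijkl D0 isotropic in \<open>auto simp: free_X_def\<close>)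
  qed
  then have "torus_class \<theta> (scalar c * ?S) = torus_class \<theta> (scalar c * 0)" for c
    by (rule scalar.mult_left_cong)
  then show "torus_curvature \<theta> i j k l = \<zero>\<^bsub>nc_torus \<theta>\<^esub>"
    by (simp only: torus_curvature_eq nc_torus_zero mult_zero_right)
qed

end
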